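(* Fix $\epsilon_0\in(0,1/2)$. If a probability density $f$ on $\mathbb{R}$ has the form $$f(x)=f(x;u_0,\sigma_0,\epsilon,H)=(1-\epsilon)\frac{1}{\sigma_0}\phi\Big(\frac{x-u_0}{\sigma_0}\Big)+\epsilon\int\frac{1}{\sigma}\phi\Big(\frac{x-u}{\sigma}\Big)\,dH(u,\sigma)$$ with $u_0\in\mathbb{R}$, $\sigma_0>0$, and with $\epsilon$ and $H$ satisfying $$0<\epsilon\le\epsilon_0,\qquad P_H(u>u_0)=1,$$ then the parameters $u_0$, $\sigma_0$ and $\epsilon$ are uniquely determined by $f$. That is, if $f$ admits two such representations, with parameters $(u_0^{(k)},\sigma_0^{(k)},\epsilon^{(k)},H^{(k)})$, $k=1,2$, each satisfying $u_0^{(k)}\in\mathbb{R}$, $\sigma_0^{(k)}>0$, $0<\epsilon^{(k)}\le\epsilon_0$ and $P_{H^{(k)}}(u>u_0^{(k)})=1$ (with the same $\epsilon_0$ for $k=1,2$), then $(u_0^{(1)},\sigma_0^{(1)},\epsilon^{(1)})=(u_0^{(2)},\sigma_0^{(2)},\epsilon^{(2)})$.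
   Context: $\phi$ denotes the density of the standard normal distribution $N(0,1)$. $H$ is a bivariate probability distribution (the mixing distribution) of $(u,\sigma)\in\mathbb{R}\times(0,\infty)$, and $P_H$ denotes probability when $(u,\sigma)\sim H$. *)

theory Defs
  imports "HOL-Probability.Probability"
begin

definition mixing_distribution :: "(real \<times> real) measure \<Rightarrow> bool" where
  "mixing_distribution H \<longleftrightarrow>
     prob_space H \<and> sets H = sets (restrict_space borel (UNIV \<times> {0<..}))"

text \<open>
  Values are extended nonnegative reals because the mixture may be infinite at individual points:
  if \<open>u\<close> has an atom and \<open>1 / \<sigma>\<close> is not integrable there, the integral diverges at that atom.
  A Bochner integral would silently be \<open>0\<close> at such points.
\<close>

definition mixture_density ::
    "real \<Rightarrow> real \<Rightarrow> real \<Rightarrow> (real \<times> real) measure \<Rightarrow> real \<Rightarrow> ennreal" where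
  "mixture_density u\<^sub>0 \<sigma>\<^sub>0 \<epsilon> H x =
     ennreal ((1 - \<epsilon>) * (1 / \<sigma>\<^sub>0 * std_normal_density ((x - u\<^sub>0) / \<sigma>\<^sub>0)))
     + ennreal \<epsilon> * (\<integral>\<^sup>+(u, \<sigma>). ennreal (1 / \<sigma> * std_normal_density ((x - u) / \<sigma>)) \<partial>H)"

definition prob_density :: "(real \<Rightarrow> ennreal) \<Rightarrow> bool" where
  "prob_density f \<longleftrightarrow> f \<in> borel_measurable lborel \<and> (\<integral>\<^sup>+x. f x \<partial>lborel) = 1"

text \<open>
  The equality of densities is required only up to Lebesgue null sets, as a density is determined
  by its distribution only up to such sets; an everywhere valid representation is a special case.
\<close>

definition mixture_representation ::
    "real \<Rightarrow> (real \<Rightarrow> ennreal) \<Rightarrow> real \<Rightarrow> real \<Rightarrow> real \<Rightarrow> (real \<times> real) measure \<Rightarrow> bool" where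
  "mixture_representation \<epsilon>\<^sub>0 f u\<^sub>0 \<sigma>\<^sub>0 \<epsilon> H \<longleftrightarrow>
     mixing_distribution H \<and> 0 < \<sigma>\<^sub>0 \<and> 0 < \<epsilon> \<and> \<epsilon> \<le> \<epsilon>\<^sub>0 \<and>
     \<P>(p in H. fst p > u\<^sub>0) = 1 \<and>
     (AE x in lborel. f x = mixture_density u\<^sub>0 \<sigma>\<^sub>0 \<epsilon> H x)"

end

theory Submission
  imports Defs "HOL-Real_Asymp.Real_Asymp"
begin

text \<open>
  Only the restriction of \<open>f\<close> to a half-line enters the argument. Let \<open>u1 \<le> u2\<close> and look at
  \<open>f (u1 - y)\<close> for \<open>y > 0\<close>. On this half-line, a Gaussian with mean to the right of \<open>u1\<close> is a
  mixture of Gaussians centred at \<open>u1\<close>: for \<open>d > 0\<close> there is a nonnegative function \<open>m\<close> of the precision \<open>v = 1 / variance\<close> with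
  \<open>N(u1 + d, \<sigma>)(u1 - y) = \<integral> m(v) exp (- v y^2 / 2) dv\<close> for all \<open>y > 0\<close>
  (\<open>normal_density_as_laplace\<close>). Probabilistically, a Brownian path that runs from the mean to
  \<open>u1 - y\<close> has to cross \<open>u1\<close>, and by the strong Markov property it starts afresh there; the law of
  the first passage time has a density. What matters is that \<open>m\<close> is a density and so has no atoms.
  A component with mean exactly \<open>u1\<close>, in contrast, puts all its mass on the single precision
  \<open>1 / \<sigma>^2\<close>. Hence, on the half-line \<open>x < u1\<close>, the first representation exhibits \<open>f\<close> as a Laplace
  transform in \<open>y^2 / 2\<close> whose only atom comes from the component \<open>(u1, \<sigma>1)\<close>, of weight
  \<open>1 - \<epsilon>1 > 0\<close>. The second one must produce the same atom, and only \<open>(u2, \<sigma>2)\<close> can do so. This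
  forces \<open>u2 = u1\<close>, \<open>\<sigma>2 = \<sigma>1\<close>, and by comparing the masses \<open>\<epsilon>2 = \<epsilon>1\<close>.

  The atom is read off from countably many values of \<open>f\<close>. At the points \<open>y = sqrt n * \<eta>\<close> the kernel
  \<open>exp (- v y^2 / 2)\<close> is the power \<open>w^n\<close> of \<open>w = exp (- v \<eta>^2 / 2)\<close>, so finite linear combinations of
  these values integrate polynomials in \<open>w\<close>. The polynomials \<open>(1 - (w - a)^2)^k\<close> are bounded by \<open>1\<close>
  on \<open>(0, 1)\<close> and tend to the indicator of \<open>w = a\<close>; dominated convergence, once over the precisions
  and once over the mixing distribution, isolates the atom at \<open>a\<close>. For almost every \<open>\<eta>\<close> the
  sampling points avoid the null set on which the two representations may differ.
\<close>

section \<open>The left half of a Gaussian as a mixture of centred Gaussians\<close>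

lemma std_normal_cdf_has_derivative:
  "(cdf std_normal_distribution has_real_derivative std_normal_density x) (at x)"
proof -
  interpret D: real_distribution std_normal_distribution
    by (rule real_dist_normal_dist)
  have cont: "continuous_on {x - 1..x + 1} std_normal_density"
    unfolding normal_density_def by (intro continuous_intros) auto
  have eq: "cdf std_normal_distribution y =
      cdf std_normal_distribution (x - 1) + integral {x - 1..y} std_normal_density"
    if y: "y \<in> {x - 1..x + 1}" for y
  proof -
    have int: "set_integrable lborel {x - 1..y} std_normal_density"
      unfolding set_integrable_def
      by (intro integrable_mult_indicator) auto
    have "cdf std_normal_distribution y - cdf std_normal_distribution (x - 1) =
        measure std_normal_distribution {x - 1<..y}"
    proof (cases "y = x - 1")
      case False
      then show ?thesis using y by (intro D.cdf_diff_eq) auto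
    qed simp
    also have "\<dots> = measure std_normal_distribution {x - 1..y}"
    proof -
      have "AE t in std_normal_distribution. t \<in> {x - 1<..y} \<longleftrightarrow> t \<in> {x - 1..y}"
        using AE_lborel_singleton[of "x - 1"] by (subst AE_density) auto
      then show ?thesis by (intro D.finite_measure_eq_AE) auto
    qed
    also have "\<dots> = (\<integral>t. indicator {x - 1..y} t * std_normal_density t \<partial>lborel)"
    proof -
      have "measure std_normal_distribution {x - 1..y} =
          (\<integral>t. indicator {x - 1..y} t \<partial>std_normal_distribution)"
        by (simp add: measure_def)
      also have "\<dots> = (\<integral>t. std_normal_density t * indicator {x - 1..y} t \<partial>lborel)"
        by (subst integral_density) auto
      finally show ?thesis by (simp add: mult.commute)
    qed
    also have "\<dots> = integral {x - 1..y} std_normal_density"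
      using set_borel_integral_eq_integral(2)[OF int]
      by (simp add: set_lebesgue_integral_def)
    finally show ?thesis by simp
  qed
  have "((\<lambda>y. cdf std_normal_distribution (x - 1) + integral {x - 1..y} std_normal_density)
      has_real_derivative std_normal_density x) (at x within {x - 1..x + 1})"
    using integral_has_real_derivative[OF cont, of x] by (auto intro!: derivative_eq_intros)
  then have "(cdf std_normal_distribution has_real_derivative std_normal_density x)
      (at x within {x - 1..x + 1})"
    by (rule has_field_derivative_transform_within[where d = 1]) (simp_all only: eq[symmetric], simp_all)
  then show ?thesis
    by (simp add: at_within_Icc_at)
qed

text \<open>
  The density of the Levy distribution with scale \<open>c^2\<close>, which is the law of the first passage time
  of a standard Brownian motion through the level \<open>c\<close>. Its Laplace transform at \<open>\<lambda>\<close> is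
  \<open>exp (- c * sqrt (2 * \<lambda>))\<close>, which for \<open>\<lambda> = y^2 / 2\<close> is an exponential in \<open>y\<close>.
\<close>

definition levy_density :: "real \<Rightarrow> real \<Rightarrow> real" where
  "levy_density c v = c / (v * sqrt v) * std_normal_density (c / sqrt v)"

text \<open>
  By the reflection principle for Brownian motion with drift, the integrand has an elementary
  antiderivative in terms of the normal distribution function, namely \<open>F\<close> below (the inverse
  Gaussian distribution function up to the factor \<open>exp (- c y)\<close>). Completing the square shows that
  the two Gaussian factors in its derivative coincide, and the terms with \<open>y\<close> cancel.
\<close>

lemma levy_density_laplace:
  fixes c y :: real
  assumes c: "0 < c" and y: "0 < y"
  shows "has_bochner_integral lborel
      (\<lambda>v. indicator {0<..} v * levy_density c v * exp (- (y\<^sup>2 * v / 2))) (exp (- (c * y)))"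
proof -
  let ?Q = "cdf std_normal_distribution"
  interpret D: real_distribution std_normal_distribution
    by (rule real_dist_normal_dist)
  define F where "F v = exp (- (c * y)) * ?Q (y * sqrt v - c / sqrt v)
      + exp (c * y) * ?Q (- (y * sqrt v) - c / sqrt v)" for v
  define f where "f v = levy_density c v * exp (- (y\<^sup>2 * v / 2))" for v
  have DQ: "((\<lambda>v. ?Q (g v)) has_real_derivative (std_normal_density (g v) * g')) (at v)"
    if "(g has_real_derivative g') (at v)" for g g' v
    by (rule DERIV_chain2[OF std_normal_cdf_has_derivative that])
  have ex1: "exp (- (c * y)) * std_normal_density (y * sqrt v - c / sqrt v) =
      std_normal_density (c / sqrt v) * exp (- (y\<^sup>2 * v / 2))" if "v > 0" for v
  proof -
    have "- (c * y) - (y * sqrt v - c / sqrt v)\<^sup>2 / 2 = - (c / sqrt v)\<^sup>2 / 2 - y\<^sup>2 * v / 2"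
      using that by (simp add: power2_diff power_mult_distrib field_simps)
        (simp add: power2_eq_square)
    then show ?thesis
      by (simp add: std_normal_density_def exp_add[symmetric])
  qed
  have ex2: "exp (c * y) * std_normal_density (- (y * sqrt v) - c / sqrt v) =
      std_normal_density (c / sqrt v) * exp (- (y\<^sup>2 * v / 2))" if "v > 0" for v
  proof -
    have "c * y - (- (y * sqrt v) - c / sqrt v)\<^sup>2 / 2 = - (c / sqrt v)\<^sup>2 / 2 - y\<^sup>2 * v / 2"
      using that by (simp add: power2_diff power_mult_distrib field_simps)
        (simp add: power2_eq_square)
    then show ?thesis
      by (simp add: std_normal_density_def exp_add[symmetric])
  qed
  have deriv: "(F has_real_derivative f v) (at v)" if v: "v > 0" for v
  proof -
    have sq: "sqrt v * sqrt v = v" "sqrt v > 0" using v by auto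
    have d_mult: "((\<lambda>v. y * sqrt v) has_real_derivative y / (2 * sqrt v)) (at v)"
      using v by (auto intro!: derivative_eq_intros simp: field_simps)
    have d_div: "((\<lambda>v. c / sqrt v) has_real_derivative - (c / (2 * (v * sqrt v)))) (at v)"
      using v sq by (auto intro!: derivative_eq_intros simp: divide_simps)
    have d1: "((\<lambda>v. y * sqrt v - c / sqrt v) has_real_derivative
        (y / (2 * sqrt v) + c / (2 * (v * sqrt v)))) (at v)"
      using DERIV_diff[OF d_mult d_div] by simp
    have d2: "((\<lambda>v. - (y * sqrt v) - c / sqrt v) has_real_derivative
        (- (y / (2 * sqrt v)) + c / (2 * (v * sqrt v)))) (at v)"
      using DERIV_diff[OF DERIV_minus[OF d_mult] d_div] by simp
    have "(F has_real_derivative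
        (exp (- (c * y)) * (std_normal_density (y * sqrt v - c / sqrt v) *
            (y / (2 * sqrt v) + c / (2 * (v * sqrt v))))
         + exp (c * y) * (std_normal_density (- (y * sqrt v) - c / sqrt v) *
            (- (y / (2 * sqrt v)) + c / (2 * (v * sqrt v)))))) (at v)"
      unfolding F_def by (intro DERIV_add DERIV_cmult DQ d1 d2)
    also have "(exp (- (c * y)) * (std_normal_density (y * sqrt v - c / sqrt v) *
            (y / (2 * sqrt v) + c / (2 * (v * sqrt v))))
         + exp (c * y) * (std_normal_density (- (y * sqrt v) - c / sqrt v) *
            (- (y / (2 * sqrt v)) + c / (2 * (v * sqrt v))))) = f v"
      unfolding mult.assoc[symmetric] ex1[OF v] ex2[OF v] f_def levy_density_def
      by (simp add: algebra_simps)
    finally show ?thesis .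
  qed
  have cont: "isCont f v" if "v > 0" for v
    unfolding f_def levy_density_def normal_density_def
    using that by (intro continuous_intros) auto
  have nonneg: "0 \<le> f v" if "v > 0" for v
    using that c by (simp add: f_def levy_density_def)
  have lim0: "(F \<longlongrightarrow> 0) (at_right 0)"
  proof -
    have a: "filterlim (\<lambda>v. y * sqrt v - c / sqrt v) at_bot (at_right 0)"
      "filterlim (\<lambda>v. - (y * sqrt v) - c / sqrt v) at_bot (at_right 0)"
      using c y by real_asymp+
    have "(F \<longlongrightarrow> exp (- (c * y)) * 0 + exp (c * y) * 0) (at_right 0)"
      unfolding F_def
      by (intro tendsto_intros filterlim_compose[OF D.cdf_lim_at_bot] a)
    then show ?thesis by simp
  qed
  have liminf: "(F \<longlongrightarrow> exp (- (c * y))) at_top"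
  proof -
    have a: "filterlim (\<lambda>v. y * sqrt v - c / sqrt v) at_top at_top"
      "filterlim (\<lambda>v. - (y * sqrt v) - c / sqrt v) at_bot at_top"
      using c y by real_asymp+
    have "(F \<longlongrightarrow> exp (- (c * y)) * 1 + exp (c * y) * 0) at_top"
      unfolding F_def
      by (intro tendsto_intros filterlim_compose[OF D.cdf_lim_at_bot]
          filterlim_compose[OF D.cdf_lim_at_top_prob] a)
    then show ?thesis by simp
  qed
  have lim0': "((F \<circ> real_of_ereal) \<longlongrightarrow> 0) (at_right (0::ereal))"
    using lim0 ereal_tendsto_simps1(2)[of F 0 0] by (simp add: zero_ereal_def)
  have liminf': "((F \<circ> real_of_ereal) \<longlongrightarrow> exp (- (c * y))) (at_left (\<infinity>::ereal))"
    using liminf by (simp add: ereal_tendsto_simps1)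
  have ae: "AE v in lborel. (0::ereal) < ereal v \<longrightarrow> ereal v < \<infinity> \<longrightarrow> 0 \<le> f v"
    using nonneg by auto
  note FTC = interval_integral_FTC_nonneg[of 0 "\<infinity>" F f, OF _ _ _ ae lim0' liminf']
  have "set_integrable lborel (einterval 0 \<infinity>) f"
    by (rule FTC) (auto intro: deriv cont)
  moreover have "(LBINT v=0..\<infinity>. f v) = exp (- (c * y)) - 0"
    by (rule FTC) (auto intro: deriv cont)
  moreover have "einterval 0 \<infinity> = {0<..}"
    by (auto simp: einterval_def)
  ultimately show ?thesis
    by (simp add: has_bochner_integral_iff f_def set_integrable_def mult.assoc
        set_lebesgue_integral_def interval_lebesgue_integral_def)
qed

lemma levy_density_nonneg: "0 \<le> c \<Longrightarrow> 0 < v \<Longrightarrow> 0 \<le> levy_density c v"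
  by (simp add: levy_density_def)

lemma normal_density_left_of_mean:
  assumes \<sigma>: "0 < \<sigma>"
  shows "normal_density d \<sigma> (- y) = normal_density d \<sigma> 0 *
      (exp (- (y\<^sup>2 / 2 * (1 / \<sigma>\<^sup>2))) * exp (- (d / \<sigma>\<^sup>2 * y)))"
proof -
  have "- (- y - d)\<^sup>2 / (2 * \<sigma>\<^sup>2) =
      - (0 - d)\<^sup>2 / (2 * \<sigma>\<^sup>2) + (- (y\<^sup>2 / 2 * (1 / \<sigma>\<^sup>2)) + - (d / \<sigma>\<^sup>2 * y))"
    using \<sigma> by (simp add: power2_eq_square field_simps)
  then show ?thesis
    by (simp only: normal_density_def exp_add mult.assoc)
qed

text \<open>
  In the factorization of \<open>normal_density_left_of_mean\<close>, the factor with \<open>y\<close> is the Laplace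
  transform at \<open>y^2 / 2\<close> of a Levy density with \<open>c = d / \<sigma>^2\<close>. The factor with \<open>y^2\<close> translates
  that density by \<open>1 / \<sigma>^2\<close>.
\<close>

definition precision_density :: "real \<Rightarrow> real \<Rightarrow> real \<Rightarrow> real" where
  "precision_density d \<sigma> v = normal_density d \<sigma> 0 *
     (indicator {0<..} (v - 1 / \<sigma>\<^sup>2) * levy_density (d / \<sigma>\<^sup>2) (v - 1 / \<sigma>\<^sup>2))"

lemma normal_density_as_laplace:
  assumes d: "0 < d" and \<sigma>: "0 < \<sigma>" and y: "0 < y"
  shows "has_bochner_integral lborel
      (\<lambda>v. precision_density d \<sigma> v * exp (- (y\<^sup>2 * v / 2))) (normal_density d \<sigma> (- y))"
proof -
  define b where "b = 1 / \<sigma>\<^sup>2"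
  have "has_bochner_integral lborel
      (\<lambda>v. indicator {0<..} v * levy_density (d / \<sigma>\<^sup>2) v * exp (- (y\<^sup>2 * v / 2)))
      (exp (- (d / \<sigma>\<^sup>2 * y)))"
    using d \<sigma> y by (intro levy_density_laplace) auto
  then have "has_bochner_integral lborel
      (\<lambda>v. indicator {0<..} (- b + 1 * v) * levy_density (d / \<sigma>\<^sup>2) (- b + 1 * v)
        * exp (- (y\<^sup>2 * (- b + 1 * v) / 2))) (exp (- (d / \<sigma>\<^sup>2 * y)))"
    by (subst (asm) lborel_has_bochner_integral_real_affine_iff[where c=1 and t="- b"]) auto
  then have "has_bochner_integral lborel
      (\<lambda>v. (normal_density d \<sigma> 0 * exp (- (y\<^sup>2 / 2 * b))) *
        (indicator {0<..} (- b + 1 * v) * levy_density (d / \<sigma>\<^sup>2) (- b + 1 * v)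
        * exp (- (y\<^sup>2 * (- b + 1 * v) / 2))))
      ((normal_density d \<sigma> 0 * exp (- (y\<^sup>2 / 2 * b))) * exp (- (d / \<sigma>\<^sup>2 * y)))"
    by (intro has_bochner_integral_mult_right)
  also have "(normal_density d \<sigma> 0 * exp (- (y\<^sup>2 / 2 * b))) * exp (- (d / \<sigma>\<^sup>2 * y)) =
      normal_density d \<sigma> (- y)"
    using normal_density_left_of_mean[OF \<sigma>, of d y] by (simp add: b_def)
  also have "(\<lambda>v. (normal_density d \<sigma> 0 * exp (- (y\<^sup>2 / 2 * b))) *
        (indicator {0<..} (- b + 1 * v) * levy_density (d / \<sigma>\<^sup>2) (- b + 1 * v)
        * exp (- (y\<^sup>2 * (- b + 1 * v) / 2)))) =
      (\<lambda>v. precision_density d \<sigma> v * exp (- (y\<^sup>2 * v / 2)))"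
  proof
    fix v
    have "exp (- (y\<^sup>2 / 2 * b)) * exp (- (y\<^sup>2 * (- b + 1 * v) / 2)) = exp (- (y\<^sup>2 * v / 2))"
      by (simp add: exp_add[symmetric] field_simps)
    then show "(normal_density d \<sigma> 0 * exp (- (y\<^sup>2 / 2 * b))) *
        (indicator {0<..} (- b + 1 * v) * levy_density (d / \<sigma>\<^sup>2) (- b + 1 * v)
        * exp (- (y\<^sup>2 * (- b + 1 * v) / 2))) =
        precision_density d \<sigma> v * exp (- (y\<^sup>2 * v / 2))"
      by (simp add: precision_density_def b_def mult_ac)
  qed
  finally show ?thesis .
qed

lemma precision_density_nonneg:
  assumes "0 < d" "0 < \<sigma>"
  shows "0 \<le> precision_density d \<sigma> v"
proof -
  have "0 \<le> indicator {0<..} t * levy_density (d / \<sigma>\<^sup>2) t" for t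
    using assms levy_density_nonneg[of "d / \<sigma>\<^sup>2" t] by (cases "0 < t") simp_all
  then show ?thesis
    unfolding precision_density_def by (rule mult_nonneg_nonneg[OF normal_density_nonneg])
qed

lemma precision_density_eq_0: "v \<le> 0 \<Longrightarrow> precision_density d \<sigma> v = 0"
proof -
  assume "v \<le> 0"
  moreover have "0 \<le> 1 / \<sigma>\<^sup>2" by simp
  ultimately have "\<not> 0 < v - 1 / \<sigma>\<^sup>2" by linarith
  then show ?thesis by (simp add: precision_density_def)
qed

section \<open>Detecting an atom of the precision by sampling\<close>

text \<open>
  The index is shifted by one because \<open>y = 0\<close> has to be avoided: there a mixture may be infinite,
  and \<open>0\<close> is not in the open half-line. The shift costs one additional factor \<open>w\<close> in the sums of
  exponentials below.
\<close>

definition sampled_sum :: "real poly \<Rightarrow> real \<Rightarrow> (real \<Rightarrow> real) \<Rightarrow> real" where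
  "sampled_sum p \<eta> g = (\<Sum>i\<le>degree p. coeff p i * g (sqrt (real (Suc i)) * \<eta>))"

text \<open>
  Powers of a parabola that is \<open>1\<close> at \<open>a\<close> and lies in \<open>(0, 1)\<close> elsewhere on \<open>(0, 1)\<close>, so that
  the sequence tends boundedly to the indicator of \<open>a\<close>.
\<close>

definition peak_poly :: "real \<Rightarrow> nat \<Rightarrow> real poly" where
  "peak_poly a k = (1 - [:- a, 1:]\<^sup>2) ^ k"

lemma poly_peak_poly: "poly (peak_poly a k) w = (1 - (w - a)\<^sup>2) ^ k"
  by (simp add: peak_poly_def poly_power)

lemma peak_base_bounds:
  assumes "a \<in> {0<..<1}" "w \<in> {0<..<1::real}"
  shows "0 \<le> 1 - (w - a)\<^sup>2" "1 - (w - a)\<^sup>2 \<le> 1"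
proof -
  have "\<bar>w - a\<bar> \<le> 1" using assms by auto
  then show "0 \<le> 1 - (w - a)\<^sup>2" by (simp add: abs_square_le_1)
qed simp

lemma poly_peak_poly_bounds:
  assumes "a \<in> {0<..<1}" "w \<in> {0<..<1::real}"
  shows "0 \<le> poly (peak_poly a k) w" "poly (peak_poly a k) w \<le> 1"
  using peak_base_bounds[OF assms] by (auto simp: poly_peak_poly intro: power_le_one)

lemma poly_peak_poly_tendsto:
  assumes "a \<in> {0<..<1}" "w \<in> {0<..<1::real}"
  shows "(\<lambda>k. poly (peak_poly a k) w) \<longlonglongrightarrow> (if w = a then 1 else 0)"
proof (cases "w = a")
  case False
  then have "1 - (w - a)\<^sup>2 < 1" by simp
  then show ?thesis
    using peak_base_bounds[OF assms] False
    by (auto simp: poly_peak_poly intro!: LIMSEQ_power_zero)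
qed (simp add: poly_peak_poly)

lemma sampled_sum_exp:
  "sampled_sum p \<eta> (\<lambda>y. b * exp (- (y\<^sup>2 * v / 2))) =
     b * exp (- (\<eta>\<^sup>2 * v / 2)) * poly p (exp (- (\<eta>\<^sup>2 * v / 2)))"
proof -
  have "exp (- ((sqrt (real (Suc i)) * \<eta>)\<^sup>2 * v / 2)) =
      exp (- (\<eta>\<^sup>2 * v / 2)) * exp (- (\<eta>\<^sup>2 * v / 2)) ^ i" for i
  proof -
    have "exp (- ((sqrt (real (Suc i)) * \<eta>)\<^sup>2 * v / 2)) = exp (real (Suc i) * (- (\<eta>\<^sup>2 * v / 2)))"
      by (simp add: power_mult_distrib mult_ac del: of_nat_Suc)
    also have "\<dots> = exp (- (\<eta>\<^sup>2 * v / 2)) ^ Suc i"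
      by (rule exp_of_nat_mult)
    finally show ?thesis by simp
  qed
  then show ?thesis
    unfolding sampled_sum_def poly_altdef
    by (simp add: sum_distrib_left mult_ac del: of_nat_Suc)
qed

lemma has_bochner_integral_sampled_sum:
  assumes "\<And>y. 0 < y \<Longrightarrow> has_bochner_integral M (\<lambda>x. G x y) (g y)" and "0 < \<eta>"
  shows "has_bochner_integral M (\<lambda>x. sampled_sum p \<eta> (G x)) (sampled_sum p \<eta> g)"
  unfolding sampled_sum_def
  by (intro has_bochner_integral_sum has_bochner_integral_mult_right assms mult_pos_pos)
     (use assms(2) in auto)

text \<open>
  Sampling a Laplace transform \<open>g\<close> with a peak polynomial \<open>p\<close> gives the integral of
  \<open>m(v) * w * p(w)\<close> with \<open>w = exp (- v \<eta>^2 / 2)\<close>. It is dominated by the integral of \<open>m(v) * w\<close>,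
  which is \<open>g \<eta>\<close>, and it vanishes in the limit because the peak is reached at one precision only.
\<close>

lemma
  assumes nonneg: "\<And>v. 0 \<le> m v" and supp: "\<And>v. v \<le> 0 \<Longrightarrow> m v = 0"
    and laplace: "\<And>y. 0 < y \<Longrightarrow>
      has_bochner_integral lborel (\<lambda>v. m v * exp (- (y\<^sup>2 * v / 2))) (g y)"
    and \<eta>: "0 < \<eta>" and a: "a \<in> {0<..<1}"
  shows sampled_sum_laplace_bound: "\<bar>sampled_sum (peak_poly a k) \<eta> g\<bar> \<le> g \<eta>"
    and sampled_sum_laplace_tendsto_0: "(\<lambda>k. sampled_sum (peak_poly a k) \<eta> g) \<longlonglongrightarrow> 0"
proof -
  define w where "w v = exp (- (\<eta>\<^sup>2 * v / 2))" for v
  define s where "s k v = m v * w v * poly (peak_poly a k) (w v)" for k v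
  have s: "has_bochner_integral lborel (s k) (sampled_sum (peak_poly a k) \<eta> g)" for k
    using has_bochner_integral_sampled_sum[where p = "peak_poly a k" and M = lborel and g = g
        and G = "\<lambda>v y. m v * exp (- (y\<^sup>2 * v / 2))", OF laplace \<eta>]
    by (simp add: sampled_sum_exp s_def[abs_def] w_def)
  have dom: "has_bochner_integral lborel (\<lambda>v. m v * w v) (g \<eta>)"
    using laplace[OF \<eta>] by (simp add: w_def)
  have w: "w v \<in> {0<..<1}" if "0 < v" for v
    using that \<eta> by (simp add: w_def)
  have bound: "\<bar>s k v\<bar> \<le> m v * w v" for k v
  proof (cases "0 < v")
    case True
    have "0 \<le> m v * w v" using nonneg by (simp add: w_def)
    then show ?thesis
      using poly_peak_poly_bounds[OF a w[OF True], of k]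
      by (simp add: s_def abs_of_nonneg mult_left_le)
  qed (simp add: s_def supp)
  show "\<bar>sampled_sum (peak_poly a k) \<eta> g\<bar> \<le> g \<eta>"
  proof -
    have "\<bar>integral\<^sup>L lborel (s k)\<bar> \<le> integral\<^sup>L lborel (\<lambda>v. \<bar>s k v\<bar>)"
      by (rule integral_abs_bound)
    also have "\<dots> \<le> integral\<^sup>L lborel (\<lambda>v. m v * w v)"
      using s[of k] dom bound by (intro integral_mono) (auto simp: has_bochner_integral_iff)
    finally have "\<bar>integral\<^sup>L lborel (s k)\<bar> \<le> integral\<^sup>L lborel (\<lambda>v. m v * w v)" .
    then show ?thesis
      using s dom by (simp add: has_bochner_integral_iff)
  qed
  \<comment> \<open>the only precision with \<open>w v0 = a\<close>\<close>
  define v0 where "v0 = - (2 * ln a / \<eta>\<^sup>2)"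
  have lim: "(\<lambda>k. s k v) \<longlonglongrightarrow> 0" if "v \<noteq> v0" for v
  proof (cases "0 < v")
    case True
    have "w v \<noteq> a"
    proof
      assume "w v = a"
      then have "ln a = - (\<eta>\<^sup>2 * v / 2)" by (auto simp: w_def)
      then have "v = v0" using \<eta> by (simp add: v0_def)
      with that show False by simp
    qed
    then show ?thesis
      unfolding s_def
      using poly_peak_poly_tendsto[OF a w[OF True]] by (intro tendsto_mult_right_zero) simp
  qed (simp add: s_def supp)
  have "(\<lambda>k. integral\<^sup>L lborel (s k)) \<longlonglongrightarrow> integral\<^sup>L lborel (\<lambda>v::real. 0::real)"
  proof (rule integral_dominated_convergence[where w = "\<lambda>v. m v * w v"])
    show "AE v in lborel. (\<lambda>k. s k v) \<longlonglongrightarrow> 0"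
      using AE_lborel_singleton[of v0] lim by (auto elim: AE_mp)
    show "s k \<in> borel_measurable lborel" for k
      using s by (intro borel_measurable_integrable) (simp add: has_bochner_integral_iff)
  qed (use dom bound in \<open>auto simp: has_bochner_integral_iff\<close>)
  then show "(\<lambda>k. sampled_sum (peak_poly a k) \<eta> g) \<longlonglongrightarrow> 0"
    using s by (simp add: has_bochner_integral_iff)
qed


section \<open>Mixing and comparing two representations\<close>

text \<open>
  The bound is uniform in the mean and in \<open>\<sigma>\<close>, although \<open>1 / \<sigma>\<close> may be unbounded under the mixing
  distribution: away from the mean, a small \<open>\<sigma>\<close> makes the exponential factor win. It provides the
  constant that dominates the integrals over the mixing distribution.
\<close>

lemma normal_density_left_le:
  assumes "0 \<le> d" "0 < \<sigma>" "0 < y"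
  shows "normal_density d \<sigma> (- y) \<le> 1 / y"
proof -
  define t where "t = (y + d) / \<sigma>"
  have t: "0 < t" using assms by (simp add: t_def)
  have "t \<le> 1 + t\<^sup>2 / 2"
    using zero_le_power2[of "t - 1"] by (simp add: power2_diff)
  also have "\<dots> \<le> exp (t\<^sup>2 / 2)" by (rule exp_ge_add_one_self)
  finally have texp: "t * exp (- (t\<^sup>2 / 2)) \<le> 1"
    by (simp add: exp_minus field_simps)
  have sq: "1 \<le> sqrt (2 * pi)" using pi_ge_two by simp
  have e: "- (- y - d)\<^sup>2 / (2 * \<sigma>\<^sup>2) = - (t\<^sup>2 / 2)"
    using power2_minus[of "y + d"] by (simp add: t_def power_divide)
  have "normal_density d \<sigma> (- y) = 1 / (sqrt (2 * pi) * \<sigma>) * exp (- (t\<^sup>2 / 2))"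
    unfolding normal_density_def e using assms by (simp add: real_sqrt_mult)
  also have "\<dots> = (t * exp (- (t\<^sup>2 / 2))) / (sqrt (2 * pi) * (y + d))"
    using assms by (simp add: t_def)
  also have "\<dots> \<le> 1 / (1 * y)"
    using texp sq assms t by (intro frac_le mult_mono) auto
  finally show ?thesis by simp
qed

lemma sampled_sum_normal_density:
  assumes "0 < \<sigma>"
  shows "sampled_sum p \<eta> (\<lambda>y. normal_density 0 \<sigma> (- y)) =
    normal_density 0 \<sigma> \<eta> * poly p (exp (- (\<eta>\<^sup>2 * (1 / \<sigma>\<^sup>2) / 2)))"
proof -
  have "(\<lambda>y. normal_density 0 \<sigma> (- y)) =
      (\<lambda>y. normal_density 0 \<sigma> 0 * exp (- (y\<^sup>2 * (1 / \<sigma>\<^sup>2) / 2)))"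
    using normal_density_left_of_mean[OF assms, of 0] by (simp add: mult.commute)
  moreover have "normal_density 0 \<sigma> \<eta> = normal_density 0 \<sigma> 0 * exp (- (\<eta>\<^sup>2 * (1 / \<sigma>\<^sup>2) / 2))"
    by (simp add: normal_density_def field_simps)
  ultimately show ?thesis by (simp only: sampled_sum_exp)
qed

lemma
  assumes "0 < d" "0 < \<sigma>" "0 < \<eta>" "a \<in> {0<..<1}"
  shows sampled_sum_normal_density_bound:
      "\<bar>sampled_sum (peak_poly a k) \<eta> (\<lambda>y. normal_density d \<sigma> (- y))\<bar> \<le> 1 / \<eta>"
    and sampled_sum_normal_density_tendsto_0:
      "(\<lambda>k. sampled_sum (peak_poly a k) \<eta> (\<lambda>y. normal_density d \<sigma> (- y))) \<longlonglongrightarrow> 0"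
proof -
  note L = precision_density_nonneg[OF assms(1,2)] precision_density_eq_0
    normal_density_as_laplace[OF assms(1,2)] assms(3,4)
  show "\<bar>sampled_sum (peak_poly a k) \<eta> (\<lambda>y. normal_density d \<sigma> (- y))\<bar> \<le> 1 / \<eta>"
    using order_trans[OF sampled_sum_laplace_bound[OF L] normal_density_left_le] assms by simp
  show "(\<lambda>k. sampled_sum (peak_poly a k) \<eta> (\<lambda>y. normal_density d \<sigma> (- y))) \<longlonglongrightarrow> 0"
    by (rule sampled_sum_laplace_tendsto_0[OF L])
qed

lemma normal_density_shift: "normal_density u \<sigma> (b - y) = normal_density (u - b) \<sigma> (- y)"
  by (simp add: normal_density_def power2_eq_square algebra_simps)

text \<open>
  The barrier \<open>b\<close> is independent of the leftmost mean of the representation that \<open>H\<close> belongs to,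
  since both representations have to be viewed from the smaller of the two leftmost means.
\<close>

locale right_mixing =
  fixes H :: "(real \<times> real) measure" and b :: real
  assumes mixing: "mixing_distribution H"
    and right: "AE p in H. b < fst p"
begin

sublocale prob_space H
  using mixing by (simp add: mixing_distribution_def)

lemma snd_pos: "p \<in> space H \<Longrightarrow> 0 < snd p"
  using mixing sets_eq_imp_space_eq[of H "restrict_space borel (UNIV \<times> {0<..})"]
  by (auto simp: mixing_distribution_def space_restrict_space)

lemma measurable_normal_density [measurable]:
  "(\<lambda>p. normal_density (fst p) (snd p) x) \<in> borel_measurable H"
proof -
  have "(\<lambda>p. normal_density (fst p) (snd p) x) \<in> borel_measurable borel"
    unfolding normal_density_def borel_prod[symmetric] by measurable
  then have "(\<lambda>p. normal_density (fst p) (snd p) x) \<in>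
      borel_measurable (restrict_space borel (UNIV \<times> {0<..}))"
    by (rule measurable_restrict_space1)
  then show ?thesis
    using mixing by (simp add: mixing_distribution_def cong: measurable_cong_sets)
qed

definition mixture :: "real \<Rightarrow> real" where
  "mixture x = (\<integral>p. normal_density (fst p) (snd p) x \<partial>H)"

lemma has_bochner_integral_mixture:
  assumes "0 < y"
  shows "has_bochner_integral H (\<lambda>p. normal_density (fst p) (snd p) (b - y)) (mixture (b - y))"
proof -
  have "integrable H (\<lambda>p. normal_density (fst p) (snd p) (b - y))"
  proof (rule integrable_const_bound[where B = "1 / y"])
    show "AE p in H. norm (normal_density (fst p) (snd p) (b - y)) \<le> 1 / y"
      using right AE_space
    proof eventually_elim
      case (elim p)
      then show ?case
        using normal_density_left_le[of "fst p - b" "snd p" y] snd_pos assms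
        by (simp add: normal_density_shift)
    qed
  qed simp
  then show ?thesis by (simp add: has_bochner_integral_iff mixture_def)
qed

lemma sampled_sum_mixture_tendsto_0:
  assumes \<eta>: "0 < \<eta>" and a: "a \<in> {0<..<1}"
  shows "(\<lambda>k. sampled_sum (peak_poly a k) \<eta> (\<lambda>y. mixture (b - y))) \<longlonglongrightarrow> 0"
proof -
  define s where
    "s k p = sampled_sum (peak_poly a k) \<eta> (\<lambda>y. normal_density (fst p) (snd p) (b - y))" for k p
  have s: "has_bochner_integral H (s k)
      (sampled_sum (peak_poly a k) \<eta> (\<lambda>y. mixture (b - y)))" for k
    unfolding s_def
    by (rule has_bochner_integral_sampled_sum[OF has_bochner_integral_mixture \<eta>])
  have "(\<lambda>k. integral\<^sup>L H (s k)) \<longlonglongrightarrow> integral\<^sup>L H (\<lambda>p. 0::real)"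
  proof (rule integral_dominated_convergence[where w = "\<lambda>p. 1 / \<eta>"])
    show "AE p in H. (\<lambda>k. s k p) \<longlonglongrightarrow> 0"
      using right AE_space
    proof eventually_elim
      case (elim p)
      then show ?case
        using sampled_sum_normal_density_tendsto_0[of "fst p - b" "snd p" \<eta> a] snd_pos \<eta> a
        by (simp add: s_def normal_density_shift)
    qed
    show "AE p in H. norm (s k p) \<le> 1 / \<eta>" for k
      using right AE_space
    proof eventually_elim
      case (elim p)
      then show ?case
        using sampled_sum_normal_density_bound[of "fst p - b" "snd p" \<eta> a] snd_pos \<eta> a
        by (simp add: s_def normal_density_shift)
    qed
  qed (use s in \<open>auto simp: has_bochner_integral_iff\<close>)
  then show ?thesis
    using s by (simp add: has_bochner_integral_iff)
qed

lemma mixture_density_eq_ennreal: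
  assumes "x < b" "0 < \<sigma>" "0 \<le> \<epsilon>" "\<epsilon> \<le> 1"
  shows "mixture_density u \<sigma> \<epsilon> H x =
    ennreal ((1 - \<epsilon>) * normal_density u \<sigma> x + \<epsilon> * mixture x)"
proof -
  have scale: "1 / \<tau> * std_normal_density ((x - v) / \<tau>) = normal_density v \<tau> x" if "0 < \<tau>" for v \<tau>
    using that by (simp add: normal_density_def real_sqrt_mult power_divide mult_ac)
  have "(\<integral>\<^sup>+(v, \<tau>). ennreal (1 / \<tau> * std_normal_density ((x - v) / \<tau>)) \<partial>H) =
      (\<integral>\<^sup>+p. ennreal (normal_density (fst p) (snd p) x) \<partial>H)"
  proof (rule nn_integral_cong)
    fix p assume "p \<in> space H"
    then show "(case p of (v, \<tau>) \<Rightarrow> ennreal (1 / \<tau> * std_normal_density ((x - v) / \<tau>))) =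
        ennreal (normal_density (fst p) (snd p) x)"
      using scale[OF snd_pos] by (simp add: case_prod_beta)
  qed
  also have "\<dots> = ennreal (mixture x)"
    unfolding mixture_def
    using has_bochner_integral_mixture[of "b - x"] assms
    by (intro nn_integral_eq_integral) (auto simp: has_bochner_integral_iff)
  finally have "mixture_density u \<sigma> \<epsilon> H x =
      ennreal ((1 - \<epsilon>) * normal_density u \<sigma> x) + ennreal \<epsilon> * ennreal (mixture x)"
    unfolding mixture_density_def scale[OF assms(2)] by simp
  also have "\<dots> = ennreal ((1 - \<epsilon>) * normal_density u \<sigma> x) + ennreal (\<epsilon> * mixture x)"
    using assms by (simp add: ennreal_mult')
  also have "\<dots> = ennreal ((1 - \<epsilon>) * normal_density u \<sigma> x + \<epsilon> * mixture x)"
    using assms by (intro ennreal_plus[symmetric]) (auto simp: mixture_def)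
  finally show ?thesis .
qed

end

lemma sampled_sum_linear:
  "sampled_sum p \<eta> (\<lambda>y. r * g y + s * h y) = r * sampled_sum p \<eta> g + s * sampled_sum p \<eta> h"
  by (simp add: sampled_sum_def sum_distrib_left sum.distrib algebra_simps)

text \<open>
  The affine preimages of a null set are null sets, and countably many of them cannot cover the
  interval \<open>(0, 1)\<close>.
\<close>

lemma ex_sampling_step:
  assumes "AE x in lborel. P (x :: real)"
  shows "\<exists>\<eta>>0. \<forall>i. P (b - sqrt (real (Suc i)) * \<eta>)"
proof -
  obtain N where N: "\<And>x. x \<in> space lborel - N \<Longrightarrow> P x" "N \<in> null_sets lborel"
    using AE_E3[OF assms] by blast
  have meas: "N \<in> sets borel" using N(2) by auto
  have "AE x in lborel. x \<notin> N"
    using N(2) by (rule AE_not_in)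
  moreover have "Measurable.pred borel (\<lambda>x. x \<notin> N)"
    using meas by measurable
  ultimately have "AE \<eta> in lborel. b + (- sqrt (real (Suc i))) * \<eta> \<notin> N" for i
    by (intro AE_borel_affine) auto
  then have ae: "AE \<eta> in lborel. \<forall>i. b + (- sqrt (real (Suc i))) * \<eta> \<notin> N"
    by (subst AE_all_countable) blast
  have "\<exists>\<eta>>0. \<forall>i. b + (- sqrt (real (Suc i))) * \<eta> \<notin> N"
  proof (rule ccontr)
    assume neg: "\<not> ?thesis"
    have "AE \<eta> in lborel. \<eta> \<notin> {0<..<1::real}"
      using ae by eventually_elim (use neg in auto)
    then have "{0<..<1::real} \<in> null_sets lborel"
      by (subst (asm) AE_iff_null_sets[symmetric]) auto
    then show False by (auto simp: null_sets_def)
  qed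
  then show ?thesis
    using N(1) by auto
qed

lemma mixture_representation_right_mixing:
  assumes rep: "mixture_representation e f u \<sigma> \<epsilon> H" and le: "b \<le> u"
  shows "right_mixing H b"
proof
  show mix: "mixing_distribution H"
    using rep by (simp add: mixture_representation_def)
  then interpret prob_space H
    by (simp add: mixing_distribution_def)
  have "prob {p \<in> space H. u < fst p} = 1"
    using rep by (simp add: mixture_representation_def)
  from AE_prob_1[OF this] show "AE p in H. b < fst p"
    by eventually_elim (use le in auto)
qed

text \<open>
  Sampling to the left of \<open>u1\<close> with peak polynomials at the place \<open>w \<sigma>1\<close> of the atom of
  \<open>N(u1, \<sigma>1)\<close> gives the mass of this atom for the first representation and zero for the second
  one, unless that has the same leftmost component.
\<close>

lemma leftmost_component_unique:
  assumes rep1: "mixture_representation e f u1 \<sigma>1 \<epsilon>1 H1"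
    and rep2: "mixture_representation e f u2 \<sigma>2 \<epsilon>2 H2"
    and e: "e < 1" and le: "u1 \<le> u2"
  shows "u1 = u2 \<and> \<sigma>1 = \<sigma>2 \<and> \<epsilon>1 = \<epsilon>2"
proof -
  have pos: "0 < \<sigma>1" "0 < \<epsilon>1" "\<epsilon>1 < 1" "0 < \<sigma>2" "0 < \<epsilon>2" "\<epsilon>2 < 1"
    using rep1 rep2 e by (auto simp: mixture_representation_def)
  interpret H1: right_mixing H1 u1
    by (rule mixture_representation_right_mixing[OF rep1 order_refl])
  interpret H2: right_mixing H2 u1
    by (rule mixture_representation_right_mixing[OF rep2 le])
  define f1 where "f1 x = (1 - \<epsilon>1) * normal_density u1 \<sigma>1 x + \<epsilon>1 * H1.mixture x" for x
  define f2 where "f2 x = (1 - \<epsilon>2) * normal_density u2 \<sigma>2 x + \<epsilon>2 * H2.mixture x" for x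
  have "AE x in lborel. f x = mixture_density u1 \<sigma>1 \<epsilon>1 H1 x"
    "AE x in lborel. f x = mixture_density u2 \<sigma>2 \<epsilon>2 H2 x"
    using rep1 rep2 by (auto simp: mixture_representation_def)
  then have "AE x in lborel. x < u1 \<longrightarrow> f1 x = f2 x"
  proof eventually_elim
    case (elim x)
    have "0 \<le> f1 x" "0 \<le> f2 x"
      using pos by (auto simp: f1_def f2_def H1.mixture_def H2.mixture_def)
    moreover have "f x = ennreal (f1 x)" "f x = ennreal (f2 x)" if "x < u1"
      unfolding f1_def f2_def
      using elim pos that H1.mixture_density_eq_ennreal[of x \<sigma>1 \<epsilon>1 u1]
        H2.mixture_density_eq_ennreal[of x \<sigma>2 \<epsilon>2 u2] by simp_all
    ultimately show ?case
      by (metis ennreal_inj)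
  qed
  from ex_sampling_step[OF this, of u1] obtain \<eta> where \<eta>: "0 < \<eta>"
    and eq': "\<forall>i. u1 - sqrt (real (Suc i)) * \<eta> < u1 \<longrightarrow>
      f1 (u1 - sqrt (real (Suc i)) * \<eta>) = f2 (u1 - sqrt (real (Suc i)) * \<eta>)"
    by blast
  have eq: "f1 (u1 - sqrt (real (Suc i)) * \<eta>) = f2 (u1 - sqrt (real (Suc i)) * \<eta>)" for i
  proof -
    have "0 < sqrt (real (Suc i)) * \<eta>"
      using \<eta> by (intro mult_pos_pos) auto
    then show ?thesis
      using eq'[rule_format, of i] by linarith
  qed
  define w where "w \<sigma> = exp (- (\<eta>\<^sup>2 * (1 / \<sigma>\<^sup>2) / 2))" for \<sigma>
  have w: "w \<sigma> \<in> {0<..<1}" if "0 < \<sigma>" for \<sigma>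
    using that \<eta> by (simp add: w_def)
  have w_inj: "\<sigma>2 = \<sigma>1" if "w \<sigma>2 = w \<sigma>1"
  proof -
    have "\<sigma>2\<^sup>2 = \<sigma>1\<^sup>2"
      using that pos \<eta> by (simp add: w_def)
    then show ?thesis
      using pos by (simp add: power2_eq_iff_nonneg)
  qed
  have lim0: "(\<lambda>k. sampled_sum (peak_poly (w \<sigma>1) k) \<eta> (\<lambda>y. normal_density 0 \<sigma> (- y)))
      \<longlonglongrightarrow> normal_density 0 \<sigma> \<eta> * (if w \<sigma> = w \<sigma>1 then 1 else 0)" if "0 < \<sigma>" for \<sigma>
    unfolding sampled_sum_normal_density[OF that] w_def[symmetric]
    by (intro tendsto_mult_left poly_peak_poly_tendsto w that pos)
  define c2 where "c2 = (if u1 = u2 \<and> \<sigma>1 = \<sigma>2 then normal_density 0 \<sigma>1 \<eta> else 0)"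
  have lim2: "(\<lambda>k. sampled_sum (peak_poly (w \<sigma>1) k) \<eta> (\<lambda>y. normal_density (u2 - u1) \<sigma>2 (- y)))
      \<longlonglongrightarrow> c2"
  proof (cases "u1 = u2")
    case True
    then have "c2 = normal_density 0 \<sigma>2 \<eta> * (if w \<sigma>2 = w \<sigma>1 then 1 else 0)"
      using w_inj by (auto simp only: c2_def simp_thms if_True if_False mult_1_right mult_zero_right split: if_split)
    then show ?thesis
      using lim0[OF pos(4)] True by (simp only: diff_self)
  next
    case False
    then show ?thesis
      using le sampled_sum_normal_density_tendsto_0[OF _ pos(4) \<eta> w[OF pos(1)], of "u2 - u1"]
      by (simp add: c2_def)
  qed
  have L1: "(\<lambda>k. sampled_sum (peak_poly (w \<sigma>1) k) \<eta> (\<lambda>y. f1 (u1 - y)))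
      \<longlonglongrightarrow> (1 - \<epsilon>1) * (normal_density 0 \<sigma>1 \<eta> * (if w \<sigma>1 = w \<sigma>1 then 1 else 0)) + \<epsilon>1 * 0"
    unfolding f1_def sampled_sum_linear normal_density_shift[of u1] diff_self
    by (intro tendsto_intros lim0 H1.sampled_sum_mixture_tendsto_0 \<eta> w pos)
  have L2: "(\<lambda>k. sampled_sum (peak_poly (w \<sigma>1) k) \<eta> (\<lambda>y. f2 (u1 - y)))
      \<longlonglongrightarrow> (1 - \<epsilon>2) * c2 + \<epsilon>2 * 0"
    unfolding f2_def sampled_sum_linear normal_density_shift[of u2]
    by (intro tendsto_intros lim2 H2.sampled_sum_mixture_tendsto_0 \<eta> w pos)
  have "sampled_sum p \<eta> (\<lambda>y. f1 (u1 - y)) = sampled_sum p \<eta> (\<lambda>y. f2 (u1 - y))" for p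
    by (simp only: sampled_sum_def eq)
  then have "(1 - \<epsilon>1) * normal_density 0 \<sigma>1 \<eta> = (1 - \<epsilon>2) * c2"
    using LIMSEQ_unique[OF L1] L2 by simp
  moreover have "0 < normal_density 0 \<sigma>1 \<eta>"
    using pos by (intro normal_density_pos)
  ultimately show ?thesis
    using pos by (auto simp: c2_def split: if_splits)
qed

theorem lemma1p2:
  fixes \<epsilon>\<^sub>0 :: real and f :: "real \<Rightarrow> ennreal"
    and u1 \<sigma>1 \<epsilon>1 u2 \<sigma>2 \<epsilon>2 :: real
    and H1 H2 :: "(real \<times> real) measure"
  assumes "0 < \<epsilon>\<^sub>0" and "\<epsilon>\<^sub>0 < 1 / 2"
    and "prob_density f"
    and "mixture_representation \<epsilon>\<^sub>0 f u1 \<sigma>1 \<epsilon>1 H1"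
    and "mixture_representation \<epsilon>\<^sub>0 f u2 \<sigma>2 \<epsilon>2 H2"
  shows "(u1, \<sigma>1, \<epsilon>1) = (u2, \<sigma>2, \<epsilon>2)"
proof (cases "u1 \<le> u2")
  case True
  then show ?thesis
    using leftmost_component_unique[OF assms(4,5)] assms(2) by simp
next
  case False
  then show ?thesis
    using leftmost_component_unique[OF assms(5,4)] assms(2) by simp
qed

end
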